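(* Under the standing assumptions A1--A4 (see context), let $\bar u\in\operatorname{dom}g$ and suppose that strong metric subregularity holds at $\bar u$ with $X\in\{Y,\mathcal U^*\}$ and constants $R,\nu,\eta>0$, i.e. $$\|u-\bar u\|_{\mathcal U}\le\frac1\nu\inf\{\|\nabla f(u)+\xi\|_X\mid\xi\in\partial g(u)\cap X\}\qquad\forall u\in B_R(\bar u)\text{ with }J(u)\le J(\bar u)+\eta.$$ Further assume that $\nabla f$ is one-sided Lipschitz with constant $L\ge0$, i.e. $$\langle\nabla f(u_1)-\nabla f(u_2),u_1-u_2\rangle\ge-L\|u_1-u_2\|_{\mathcal U}^2\qquad\forall u_1,u_2\in\operatorname{dom}g.$$ Then the Polyak--Łojasiewicz--Kurdyka property holds at $\bar u$ with the same $X$, radius $R$, $\lambda=\frac2\nu+\frac L{\nu^2}$, and $\eta$, i.e. $$J(u)-J(\bar u)\le\frac\lambda2\inf\{\|\nabla f(u)+\xi\|_X^2\mid\xi\in\partial g(u)\cap X\}\qquad\forall u\in B_R(\bar u)\text{ with }J(u)\le J(\bar u)+\eta.$$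
   Context: Standing assumptions. (A1) $\mathcal U\cong Y^*$, where $Y$ is a separable Banach space with norm $\|\cdot\|_Y$; $\langle\cdot,\cdot\rangle$ is the pairing between $Y$ and $\mathcal U$, and $\mathcal U$ carries the dual norm $\|u\|_{\mathcal U}=\sup_{\|y\|_Y\le1}\langle y,u\rangle$. (A2) $g:\mathcal U\to[0,\infty]$ is proper, convex and sequentially weak* lower semicontinuous. (A3) $f:\mathcal U\to[0,\infty)$ is sequentially weak* lower semicontinuous on $\operatorname{dom}g$, and there are a neighborhood $\mathcal N$ of $\operatorname{dom}g$ in $\mathcal U$ and a map $\nabla f:\operatorname{dom}g\to Y$ such that $f$ is Gâteaux differentiable on $\mathcal N$ with $f'(u)(\delta u)=\langle\nabla f(u),\delta u\rangle$ for all $u\in\operatorname{dom}g$, $\delta u\in\mathcal U$; moreover there is $L_{\nabla f}\ge0$ with $\|\nabla f(u_1)-\nabla f(u_2)\|_Y\le L_{\nabla f}\|u_1-u_2\|_{\mathcal U}$ for all $u_1,u_2\in\operatorname{dom}g$. (A4) With $J:=f+g$: if $\|u_k\|_{\mathcal U}\to\infty$ then $J(u_k)\to\infty$. $\mathcal U^*$ is the dual of $\mathcal U$ with its canonical norm; $Y$ is regarded as a subspace of $\mathcal U^*=Y^{**}$ via the canonical isometric embedding; $\partial g(u)\subset\mathcal U^*$ is the convex subdifferential. $B_R(\bar u)$ is the closed ball of radius $R$ around $\bar u$ in $\mathcal U$. The infimum over the empty set is $+\infty$. *)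

theory Defs
  imports "HOL-Analysis.Analysis"
begin

text \<open>
  The space \<open>\<U>\<close> is a normed space \<open>'u\<close> together with an isometric isomorphism \<open>\<Phi>\<close> onto the
  dual \<open>'y \<Rightarrow>\<^sub>L real\<close> of a Banach space \<open>'y\<close>; the pairing of \<open>y\<close> and \<open>u\<close> is \<open>\<Phi> u y\<close>.
  The operator norm on \<open>'y \<Rightarrow>\<^sub>L real\<close> is the dual norm.
\<close>

definition dual_iso :: "('u::real_normed_vector \<Rightarrow> ('y::banach \<Rightarrow>\<^sub>L real)) \<Rightarrow> bool" where
  "dual_iso \<Phi> \<longleftrightarrow> linear \<Phi> \<and> bij \<Phi> \<and> (\<forall>u. norm (\<Phi> u) = norm u)"

definition pairing :: "('u::real_normed_vector \<Rightarrow> ('y::banach \<Rightarrow>\<^sub>L real)) \<Rightarrow> 'y \<Rightarrow> 'u \<Rightarrow> real" where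
  "pairing \<Phi> y u = blinfun_apply (\<Phi> u) y"

definition canonical_embedding ::
    "('u::real_normed_vector \<Rightarrow> ('y::banach \<Rightarrow>\<^sub>L real)) \<Rightarrow> 'y \<Rightarrow> ('u \<Rightarrow>\<^sub>L real)" where
  "canonical_embedding \<Phi> y = Blinfun (pairing \<Phi> y)"

lemma canonical_embedding_apply:
  assumes "dual_iso \<Phi>"
  shows "blinfun_apply (canonical_embedding \<Phi> y) u = pairing \<Phi> y u"
proof -
  interpret linear \<Phi> using assms by (simp add: dual_iso_def)
  have "bounded_linear (pairing \<Phi> y)"
  proof (rule bounded_linear_intro[where K = "norm y"])
    fix u
    have "norm (blinfun_apply (\<Phi> u) y) \<le> norm (\<Phi> u) * norm y"
      by (rule norm_blinfun)
    then show "norm (pairing \<Phi> y u) \<le> norm u * norm y"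
      using assms by (simp add: pairing_def dual_iso_def)
  qed (simp_all add: pairing_def add scale blinfun.add_left blinfun.scaleR_left)
  then show ?thesis
    by (simp add: canonical_embedding_def bounded_linear_Blinfun_apply)
qed

definition weak_star_tendsto ::
    "('u::real_normed_vector \<Rightarrow> ('y::banach \<Rightarrow>\<^sub>L real)) \<Rightarrow> (nat \<Rightarrow> 'u) \<Rightarrow> 'u \<Rightarrow> bool" where
  "weak_star_tendsto \<Phi> us u \<longleftrightarrow> (\<forall>y. (\<lambda>k. pairing \<Phi> y (us k)) \<longlonglongrightarrow> pairing \<Phi> y u)"

definition seq_weak_star_lsc_on ::
    "('u::real_normed_vector \<Rightarrow> ('y::banach \<Rightarrow>\<^sub>L real)) \<Rightarrow> 'u set \<Rightarrow> ('u \<Rightarrow> ereal) \<Rightarrow> bool" where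
  "seq_weak_star_lsc_on \<Phi> S h \<longleftrightarrow>
     (\<forall>us u. (\<forall>k. us k \<in> S) \<longrightarrow> u \<in> S \<longrightarrow> weak_star_tendsto \<Phi> us u \<longrightarrow>
        h u \<le> liminf (\<lambda>k. h (us k)))"

definition edom :: "('u \<Rightarrow> ereal) \<Rightarrow> 'u set" where
  "edom g = {u. g u < \<infinity>}"

definition proper_fun :: "('u \<Rightarrow> ereal) \<Rightarrow> bool" where
  "proper_fun g \<longleftrightarrow> (\<forall>u. g u \<noteq> -\<infinity>) \<and> edom g \<noteq> {}"

definition econvex :: "('u::real_vector \<Rightarrow> ereal) \<Rightarrow> bool" where
  "econvex g \<longleftrightarrow>
     (\<forall>u v. \<forall>t\<in>{0<..<1}. g ((1 - t) *\<^sub>R u + t *\<^sub>R v) \<le> ereal (1 - t) * g u + ereal t * g v)"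

definition subdifferential :: "('u::real_normed_vector \<Rightarrow> ereal) \<Rightarrow> 'u \<Rightarrow> ('u \<Rightarrow>\<^sub>L real) set" where
  "subdifferential g u =
     {\<xi>. u \<in> edom g \<and> (\<forall>v. g u + ereal (blinfun_apply \<xi> (v - u)) \<le> g v)}"

definition has_gateaux_derivative ::
    "('u::real_normed_vector \<Rightarrow> real) \<Rightarrow> ('u \<Rightarrow>\<^sub>L real) \<Rightarrow> 'u \<Rightarrow> bool" where
  "has_gateaux_derivative f D u \<longleftrightarrow>
     (\<forall>h. ((\<lambda>t. (f (u + t *\<^sub>R h) - f u) / t) \<longlongrightarrow> blinfun_apply D h) (at 0))"

definition objective :: "('u \<Rightarrow> real) \<Rightarrow> ('u \<Rightarrow> ereal) \<Rightarrow> 'u \<Rightarrow> ereal" where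
  "objective f g u = ereal (f u) + g u"

text \<open>The standing assumptions; \<open>gradf\<close> is only constrained on \<open>edom g\<close>.\<close>

definition standing_A1 :: "('u::real_normed_vector \<Rightarrow> ('y::banach \<Rightarrow>\<^sub>L real)) \<Rightarrow> bool" where
  "standing_A1 \<Phi> \<longleftrightarrow> separable_space (euclidean :: 'y topology) \<and> dual_iso \<Phi>"

definition standing_A2 ::
    "('u::real_normed_vector \<Rightarrow> ('y::banach \<Rightarrow>\<^sub>L real)) \<Rightarrow> ('u \<Rightarrow> ereal) \<Rightarrow> bool" where
  "standing_A2 \<Phi> g \<longleftrightarrow>
     (\<forall>u. 0 \<le> g u) \<and> proper_fun g \<and> econvex g \<and> seq_weak_star_lsc_on \<Phi> UNIV g"

definition standing_A3 ::
    "('u::real_normed_vector \<Rightarrow> ('y::banach \<Rightarrow>\<^sub>L real)) \<Rightarrow> ('u \<Rightarrow> real) \<Rightarrow> ('u \<Rightarrow> 'y) \<Rightarrow>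
     ('u \<Rightarrow> ereal) \<Rightarrow> bool" where
  "standing_A3 \<Phi> f gradf g \<longleftrightarrow>
     (\<forall>u. 0 \<le> f u) \<and>
     seq_weak_star_lsc_on \<Phi> (edom g) (\<lambda>u. ereal (f u)) \<and>
     (\<exists>N V. open V \<and> edom g \<subseteq> V \<and> V \<subseteq> N \<and> (\<forall>u\<in>N. \<exists>D. has_gateaux_derivative f D u)) \<and>
     (\<forall>u\<in>edom g. has_gateaux_derivative f (canonical_embedding \<Phi> (gradf u)) u) \<and>
     (\<exists>Lgrad\<ge>0. \<forall>u1\<in>edom g. \<forall>u2\<in>edom g. norm (gradf u1 - gradf u2) \<le> Lgrad * norm (u1 - u2))"

definition standing_A4 :: "('u::real_normed_vector \<Rightarrow> real) \<Rightarrow> ('u \<Rightarrow> ereal) \<Rightarrow> bool" where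
  "standing_A4 f g \<longleftrightarrow>
     (\<forall>us :: nat \<Rightarrow> 'u. filterlim (\<lambda>k. norm (us k)) at_top sequentially \<longrightarrow>
        (\<lambda>k. objective f g (us k)) \<longlonglongrightarrow> \<infinity>)"

text \<open>
  The choice of the space \<open>X\<close>: \<open>Predual\<close> is \<open>Y\<close>, \<open>Bidual\<close> is \<open>\<U>\<^sup>*\<close>.  The set
  \<open>residual_norms\<close> collects the \<open>X\<close>-norms of \<open>\<nabla>f(u) + \<xi>\<close> for \<open>\<xi>\<close> in the intersection of
  \<open>\<partial>g(u)\<close> with \<open>X\<close>.  For \<open>X = Y\<close> such a \<open>\<xi>\<close> is the canonical image of some \<open>y\<close>, and
  the norm is that of \<open>Y\<close>.
\<close>

datatype residual_space = Predual | Bidual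

fun residual_norms ::
    "residual_space \<Rightarrow> ('u::real_normed_vector \<Rightarrow> ('y::banach \<Rightarrow>\<^sub>L real)) \<Rightarrow> ('u \<Rightarrow> 'y) \<Rightarrow>
     ('u \<Rightarrow> ereal) \<Rightarrow> 'u \<Rightarrow> real set" where
  "residual_norms Predual \<Phi> gradf g u =
     {norm (gradf u + y) |y. canonical_embedding \<Phi> y \<in> subdifferential g u}"
| "residual_norms Bidual \<Phi> gradf g u =
     {norm (canonical_embedding \<Phi> (gradf u) + \<xi>) |\<xi>. \<xi> \<in> subdifferential g u}"

text \<open>The infima below are taken in \<open>ereal\<close>, so they are \<open>\<infinity>\<close> over the empty set.\<close>

definition strong_metric_subregularity ::
    "residual_space \<Rightarrow> ('u::real_normed_vector \<Rightarrow> ('y::banach \<Rightarrow>\<^sub>L real)) \<Rightarrow> ('u \<Rightarrow> real) \<Rightarrow>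
     ('u \<Rightarrow> 'y) \<Rightarrow> ('u \<Rightarrow> ereal) \<Rightarrow> 'u \<Rightarrow> real \<Rightarrow> real \<Rightarrow> real \<Rightarrow> bool" where
  "strong_metric_subregularity X \<Phi> f gradf g ubar R \<nu> \<eta> \<longleftrightarrow>
     (\<forall>u\<in>cball ubar R. objective f g u \<le> objective f g ubar + ereal \<eta> \<longrightarrow>
        ereal (norm (u - ubar)) \<le> ereal (1 / \<nu>) * (INF r\<in>residual_norms X \<Phi> gradf g u. ereal r))"

definition PLK_property ::
    "residual_space \<Rightarrow> ('u::real_normed_vector \<Rightarrow> ('y::banach \<Rightarrow>\<^sub>L real)) \<Rightarrow> ('u \<Rightarrow> real) \<Rightarrow>
     ('u \<Rightarrow> 'y) \<Rightarrow> ('u \<Rightarrow> ereal) \<Rightarrow> 'u \<Rightarrow> real \<Rightarrow> real \<Rightarrow> real \<Rightarrow> bool" where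
  "PLK_property X \<Phi> f gradf g ubar R lam \<eta> \<longleftrightarrow>
     (\<forall>u\<in>cball ubar R. objective f g u \<le> objective f g ubar + ereal \<eta> \<longrightarrow>
        objective f g u - objective f g ubar
          \<le> ereal (lam / 2) * (INF r\<in>residual_norms X \<Phi> gradf g u. ereal (r\<^sup>2)))"

definition one_sided_Lipschitz ::
    "('u::real_normed_vector \<Rightarrow> ('y::banach \<Rightarrow>\<^sub>L real)) \<Rightarrow> ('u \<Rightarrow> 'y) \<Rightarrow> 'u set \<Rightarrow> real \<Rightarrow> bool" where
  "one_sided_Lipschitz \<Phi> F S L \<longleftrightarrow>
     (\<forall>u1\<in>S. \<forall>u2\<in>S. pairing \<Phi> (F u1 - F u2) (u1 - u2) \<ge> - L * (norm (u1 - u2))\<^sup>2)"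

end

theory Submission
  imports Defs
begin

text \<open>
  The gap \<open>J(u) - J(ubar)\<close> is estimated by linearising \<open>J\<close> at \<open>u\<close> and evaluating
  the linearisation at \<open>ubar\<close>.  Let \<open>\<xi> \<in> \<partial>g(u)\<close> and write \<open>w = \<nabla>f(u) + \<xi>\<close>, \<open>\<delta> = \<parallel>u - ubar\<parallel>\<close>.

  The subgradient inequality bounds \<open>g(ubar)\<close> from below by \<open>g(u) + \<xi>(ubar - u)\<close>.  For the
  nonconvex part \<open>f\<close>, the one-sided Lipschitz condition shows that the slope of \<open>f\<close> along
  the segment from \<open>u\<close> to \<open>ubar\<close>, at time \<open>t\<close>, is at least its initial slope minus
  \<open>L t \<delta>\<^sup>2\<close>; integrating over \<open>[0,1]\<close> costs \<open>L \<delta>\<^sup>2 / 2\<close>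
  (lemma \<open>one_sided_Lipschitz_imp_lower_quadratic_bound\<close>).  Adding the two gives
  \<open>J(u) - J(ubar) \<le> w(u - ubar) + L \<delta>\<^sup>2 / 2 \<le> r \<delta> + L \<delta>\<^sup>2 / 2\<close> with \<open>r\<close> the norm of \<open>w\<close> in \<open>X\<close>.
  Subregularity gives \<open>\<delta> \<le> r / \<nu>\<close>, so the right-hand side is at most
  \<open>r\<^sup>2 / \<nu> + L r\<^sup>2 / (2 \<nu>\<^sup>2)\<close>, which is half of \<open>2 / \<nu> + L / \<nu>\<^sup>2\<close> times \<open>r\<^sup>2\<close>.

  The choice of \<open>X\<close> enters only through the bound \<open>w(v) \<le> r \<parallel>v\<parallel>\<close>, which holds for the norm of
  \<open>Y\<close> as well as for that of the dual of \<open>\<U>\<close> (lemma \<open>residual_norm_bounds_functional\<close>).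
\<close>

text \<open>
  The Gateaux quotient at \<open>u + t *\<^sub>R d\<close> in direction \<open>d\<close> is the difference quotient of the
  restriction to the line through \<open>u\<close> and \<open>u + d\<close>.  It is two-sided, so the endpoints of a segment
  need no special treatment.
\<close>

lemma has_gateaux_derivative_along_line:
  assumes "has_gateaux_derivative f D (u + t *\<^sub>R d)"
  shows "((\<lambda>s. f (u + s *\<^sub>R d)) has_real_derivative blinfun_apply D d) (at t)"
  using assms unfolding has_gateaux_derivative_def DERIV_def
  by (auto simp: scaleR_add_left add.assoc)

lemma convex_edom:
  assumes "econvex g"
  shows "convex (edom g)"
proof (unfold convex_alt, intro ballI allI impI)
  fix u v and t :: real
  assume uv: "u \<in> edom g" "v \<in> edom g" and t: "0 \<le> t \<and> t \<le> 1"
  show "(1 - t) *\<^sub>R u + t *\<^sub>R v \<in> edom g"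
  proof (cases "t = 0 \<or> t = 1")
    case True
    then show ?thesis using uv by auto
  next
    case False
    then have "t \<in> {0<..<1}" using t by auto
    then have "g ((1 - t) *\<^sub>R u + t *\<^sub>R v) \<le> ereal (1 - t) * g u + ereal t * g v"
      using assms unfolding econvex_def by blast
    also have "\<dots> < \<infinity>"
      using uv t False by (cases "g u"; cases "g v") (auto simp: edom_def)
    finally show ?thesis by (simp add: edom_def)
  qed
qed

text \<open>
  A lower Taylor estimate: a one-sided Lipschitz gradient makes \<open>f\<close> weakly convex, in the sense
  that it lies above its linearisations up to a quadratic error.  With \<open>d = v - u\<close>,
  the condition at \<open>u + t *\<^sub>R d\<close> and \<open>u\<close> carries a factor \<open>t\<close> on the left and \<open>t\<^sup>2\<close> on the
  right; cancelling \<open>t\<close> bounds the loss of slope linearly in \<open>t\<close>, whence the factor \<open>1 / 2\<close>.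
\<close>

lemma one_sided_Lipschitz_imp_lower_quadratic_bound:
  assumes iso: "dual_iso \<Phi>"
    and S: "convex S" "u \<in> S" "v \<in> S"
    and deriv: "\<And>w. w \<in> S \<Longrightarrow> has_gateaux_derivative f (canonical_embedding \<Phi> (F w)) w"
    and lip: "one_sided_Lipschitz \<Phi> F S L"
  shows "f u + pairing \<Phi> (F u) (v - u) - L / 2 * (norm (v - u))\<^sup>2 \<le> f v"
proof -
  interpret linear \<Phi> using iso by (simp add: dual_iso_def)
  define d where "d = v - u"
  define p where "p t = u + t *\<^sub>R d" for t
  \<comment> \<open>up to the constant \<open>f u\<close>, the gap between \<open>f\<close> and its quadratic lower bound on the segment\<close>
  define \<phi> where
    "\<phi> t = f (p t) - t * pairing \<Phi> (F u) d + L / 2 * t\<^sup>2 * (norm d)\<^sup>2" for t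
  have pS: "p t \<in> S" if "0 \<le> t" "t \<le> 1" for t
  proof -
    have "p t = (1 - t) *\<^sub>R u + t *\<^sub>R v"
      by (simp add: p_def d_def algebra_simps)
    then show ?thesis using S that unfolding convex_alt by auto
  qed
  have slope: "pairing \<Phi> (F (p t)) d \<ge> pairing \<Phi> (F u) d - L * t * (norm d)\<^sup>2"
    if t: "0 \<le> t" "t \<le> 1" for t
  proof (cases "t = 0")
    case True
    then show ?thesis by (simp add: p_def)
  next
    case False
    have "t * pairing \<Phi> (F (p t) - F u) d = pairing \<Phi> (F (p t) - F u) (p t - u)"
      by (simp add: p_def pairing_def scale blinfun.scaleR_left)
    also have "\<dots> \<ge> - L * (norm (p t - u))\<^sup>2"
      using lip pS[OF t] S(2) unfolding one_sided_Lipschitz_def by blast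
    also have "- L * (norm (p t - u))\<^sup>2 = t * (- L * t * (norm d)\<^sup>2)"
      by (simp add: p_def power_mult_distrib power2_eq_square)
    finally have "- L * t * (norm d)\<^sup>2 \<le> pairing \<Phi> (F (p t) - F u) d"
      using False t by (simp only: mult_le_cancel_left)
    then show ?thesis
      by (simp add: pairing_def blinfun.diff_right)
  qed
  have "\<phi> 0 \<le> \<phi> 1"
  proof (rule DERIV_nonneg_imp_nondecreasing[where f = \<phi>])
    fix t :: real assume t: "0 \<le> t" "t \<le> 1"
    have "((\<lambda>s. f (p s)) has_real_derivative pairing \<Phi> (F (p t)) d) (at t)"
      using has_gateaux_derivative_along_line[OF deriv[OF pS[OF t], unfolded p_def]]
      by (simp add: p_def canonical_embedding_apply[OF iso])
    then have "(\<phi> has_real_derivative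
        pairing \<Phi> (F (p t)) d - pairing \<Phi> (F u) d + L * t * (norm d)\<^sup>2) (at t)"
      unfolding \<phi>_def by (auto intro!: derivative_eq_intros)
    moreover have "0 \<le> pairing \<Phi> (F (p t)) d - pairing \<Phi> (F u) d + L * t * (norm d)\<^sup>2"
      using slope[OF t] by linarith
    ultimately show "\<exists>y. (\<phi> has_real_derivative y) (at t) \<and> y \<ge> 0"
      by blast
  qed simp
  then show ?thesis
    by (simp add: \<phi>_def p_def d_def)
qed

text \<open>
  Both choices of \<open>X\<close> yield an admissible constant in the estimate of the functional
  \<open>\<nabla>f(u) + \<xi>\<close>: for the bidual it is the operator norm, for the predual it comes from the fact
  that \<open>\<Phi>\<close> preserves norms.
\<close>

lemma residual_norm_bounds_functional:
  assumes iso: "dual_iso \<Phi>" and r: "r \<in> residual_norms X \<Phi> gradf g u"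
  obtains \<xi> where "0 \<le> r" "\<xi> \<in> subdifferential g u"
    "\<And>v. pairing \<Phi> (gradf u) v + blinfun_apply \<xi> v \<le> r * norm v"
proof (cases X)
  case Predual
  then obtain y where y: "r = norm (gradf u + y)" "canonical_embedding \<Phi> y \<in> subdifferential g u"
    using r by auto
  have "pairing \<Phi> (gradf u) v + blinfun_apply (canonical_embedding \<Phi> y) v \<le> r * norm v" for v
  proof -
    have "pairing \<Phi> (gradf u) v + pairing \<Phi> y v = blinfun_apply (\<Phi> v) (gradf u + y)"
      by (simp add: pairing_def blinfun.add_right)
    also have "\<dots> \<le> norm (\<Phi> v) * norm (gradf u + y)"
      using norm_blinfun[of "\<Phi> v" "gradf u + y"] by simp
    finally show ?thesis
      using iso by (simp add: y(1) canonical_embedding_apply[OF iso] dual_iso_def mult.commute)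
  qed
  then show thesis using that y by auto
next
  case Bidual
  then obtain \<xi> where \<xi>: "r = norm (canonical_embedding \<Phi> (gradf u) + \<xi>)" "\<xi> \<in> subdifferential g u"
    using r by auto
  have "pairing \<Phi> (gradf u) v + blinfun_apply \<xi> v \<le> r * norm v" for v
    using norm_blinfun[of "canonical_embedding \<Phi> (gradf u) + \<xi>" v]
    by (simp add: \<xi>(1) blinfun.add_left canonical_embedding_apply[OF iso])
  then show thesis using that \<xi> by auto
qed

theorem lemma6p9:
  fixes \<Phi> :: "'u::real_normed_vector \<Rightarrow> ('y::banach \<Rightarrow>\<^sub>L real)"
    and f :: "'u \<Rightarrow> real" and gradf :: "'u \<Rightarrow> 'y" and g :: "'u \<Rightarrow> ereal"
    and X :: residual_space and ubar :: 'u and R \<nu> \<eta> L :: real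
  assumes "standing_A1 \<Phi>" and "standing_A2 \<Phi> g" and "standing_A3 \<Phi> f gradf g" and "standing_A4 f g"
    and "ubar \<in> edom g"
    and "R > 0" and "\<nu> > 0" and "\<eta> > 0"
    and "strong_metric_subregularity X \<Phi> f gradf g ubar R \<nu> \<eta>"
    and "L \<ge> 0" and "one_sided_Lipschitz \<Phi> gradf (edom g) L"
  shows "PLK_property X \<Phi> f gradf g ubar R (2 / \<nu> + L / \<nu>\<^sup>2) \<eta>"
proof (unfold PLK_property_def, intro ballI impI)
  fix u
  assume u: "u \<in> cball ubar R" "objective f g u \<le> objective f g ubar + ereal \<eta>"
  let ?lam = "2 / \<nu> + L / \<nu>\<^sup>2"
  let ?\<delta> = "norm (u - ubar)"
  have iso: "dual_iso \<Phi>"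
    using assms(1) by (simp add: standing_A1_def)
  have g_nonneg: "0 \<le> g w" for w
    using assms(2) by (simp add: standing_A2_def)
  have deriv: "has_gateaux_derivative f (canonical_embedding \<Phi> (gradf w)) w" if "w \<in> edom g" for w
    using assms(3) that by (simp add: standing_A3_def)
  have conv: "convex (edom g)"
    using assms(2) by (intro convex_edom) (simp add: standing_A2_def)
  obtain b where b: "g ubar = ereal b"
    using assms(5) g_nonneg[of ubar] by (cases "g ubar") (auto simp: edom_def)
  \<comment> \<open>the sublevel condition forces \<open>u\<close> into the domain of \<open>g\<close>\<close>
  obtain a where a: "g u = ereal a"
    using u(2) g_nonneg[of u] b by (cases "g u") (auto simp: objective_def)
  have u_dom: "u \<in> edom g"
    by (simp add: edom_def a)
  have bound: "objective f g u - objective f g ubar \<le> ereal (?lam / 2) * ereal (r\<^sup>2)"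
    if r: "r \<in> residual_norms X \<Phi> gradf g u" for r
  proof -
    obtain \<xi> where r0: "0 \<le> r" and \<xi>: "\<xi> \<in> subdifferential g u"
      and func: "\<And>v. pairing \<Phi> (gradf u) v + blinfun_apply \<xi> v \<le> r * norm v"
      using residual_norm_bounds_functional[OF iso r] by blast
    have "ereal ?\<delta> \<le> ereal (1 / \<nu>) * (INF r\<in>residual_norms X \<Phi> gradf g u. ereal r)"
      using assms(9) u unfolding strong_metric_subregularity_def by blast
    also have "\<dots> \<le> ereal (1 / \<nu>) * ereal r"
      using r assms(7) by (intro ereal_mult_left_mono INF_lower) auto
    finally have \<delta>: "?\<delta> \<le> r / \<nu>"
      by simp
    have "g u + ereal (blinfun_apply \<xi> (ubar - u)) \<le> g ubar"
      using \<xi> by (simp add: subdifferential_def)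
    then have sub: "a + blinfun_apply \<xi> (ubar - u) \<le> b"
      by (simp add: a b)
    have low: "f u + pairing \<Phi> (gradf u) (ubar - u) - L / 2 * ?\<delta>\<^sup>2 \<le> f ubar"
      using one_sided_Lipschitz_imp_lower_quadratic_bound
        [OF iso conv u_dom assms(5) deriv assms(11)]
      by (simp add: norm_minus_commute)
    interpret linear \<Phi> using iso by (simp add: dual_iso_def)
    have flip: "pairing \<Phi> (gradf u) (ubar - u) + blinfun_apply \<xi> (ubar - u)
        = - (pairing \<Phi> (gradf u) (u - ubar) + blinfun_apply \<xi> (u - ubar))"
      by (simp add: pairing_def diff blinfun.diff_left blinfun.diff_right)
    have "(f u + a) - (f ubar + b) \<le> r * ?\<delta> + L / 2 * ?\<delta>\<^sup>2"
      using sub low flip func[of "u - ubar"] by linarith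
    also have "\<dots> \<le> r * (r / \<nu>) + L / 2 * (r / \<nu>)\<^sup>2"
      using \<delta> r0 assms(10) by (intro add_mono mult_left_mono power_mono) auto
    also have "\<dots> = ?lam / 2 * r\<^sup>2"
      using assms(7) by (simp add: field_simps power2_eq_square)
    finally show ?thesis
      by (simp add: objective_def a b)
  qed
  \<comment> \<open>a positive factor may be moved inside the infimum, also when the infimum is \<open>\<infinity>\<close>\<close>
  have "0 < ?lam / 2"
    using assms(7,10) by (simp add: add_pos_nonneg)
  then have "ereal (?lam / 2) * (INF r\<in>residual_norms X \<Phi> gradf g u. ereal (r\<^sup>2))
      = (INF r\<in>residual_norms X \<Phi> gradf g u. ereal (?lam / 2) * ereal (r\<^sup>2))"
    using ereal_Inf_cmult[of "?lam / 2" "\<lambda>x. x \<in> (\<lambda>r. ereal (r\<^sup>2)) ` residual_norms X \<Phi> gradf g u"]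
    by (simp add: Setcompr_eq_image image_image)
  then show "objective f g u - objective f g ubar
      \<le> ereal (?lam / 2) * (INF r\<in>residual_norms X \<Phi> gradf g u. ereal (r\<^sup>2))"
    by (simp only:) (intro INF_greatest bound)
qed

end
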